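(* There is an algorithm which, given a prime $p$ as input, determines in finite time whether or not the Burau representation modulo $p$, $\beta_{3,p}:B_3\to \mathrm{GL}(3,\mathbb{F}_p[t,t^{-1}])$, is faithful (i.e. injective). In other words, the set of primes $p$ for which $\beta_{3,p}$ is faithful is a decidable set.
   Context: $B_3=\langle \sigma_1,\sigma_2\mid \sigma_1\sigma_2\sigma_1=\sigma_2\sigma_1\sigma_2\rangle$ is the 3-strand braid group. For a prime $p$, the Burau representation modulo $p$ is the homomorphism $\beta_{3,p}:B_3\to \mathrm{GL}(3,\mathbb{F}_p[t,t^{-1}])$ given by $$\sigma_1\mapsto\begin{pmatrix}1-t&t&0\\1&0&0\\0&0&1\end{pmatrix},\qquad \sigma_2\mapsto\begin{pmatrix}1&0&0\\0&1-t&t\\0&1&0\end{pmatrix}.$$ *)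

theory Defs
  imports "HOL-Number_Theory.Residues" "Jordan_Normal_Form.Matrix"
begin

section \<open>Algorithms: partial recursive functions on the natural numbers\<close>

datatype recf =
    Zero
  | Succ
  | Proj nat
  | Comp recf "recf list"
  | PrimRec recf recf
  | Minimize recf

text \<open>\<open>computes f xs y\<close>: the program \<open>f\<close> halts on the argument list \<open>xs\<close> with output \<open>y\<close>.
  Recursion and minimization act on the first argument; the arity of a program is
  implicit in the length of \<open>xs\<close>. The rule for \<open>Minimize\<close> requires \<open>f\<close> to halt (with a non-zero
  output) on all smaller candidates, so that unbounded search is modelled faithfully.\<close>

inductive computes :: "recf \<Rightarrow> nat list \<Rightarrow> nat \<Rightarrow> bool" where
  Zero: "computes Zero xs 0"
| Succ: "computes Succ [x] (Suc x)"
| Proj: "i < length xs \<Longrightarrow> computes (Proj i) xs (xs ! i)"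
| Comp: "length ys = length gs \<Longrightarrow>
    (\<forall>i < length gs. computes (gs ! i) xs (ys ! i)) \<Longrightarrow>
    computes f ys y \<Longrightarrow> computes (Comp f gs) xs y"
| PrimRec_0: "computes f xs y \<Longrightarrow> computes (PrimRec f g) (0 # xs) y"
| PrimRec_Suc: "computes (PrimRec f g) (n # xs) r \<Longrightarrow> computes g (n # r # xs) y \<Longrightarrow>
    computes (PrimRec f g) (Suc n # xs) y"
| Minimize: "computes f (n # xs) 0 \<Longrightarrow>
    (\<forall>m < n. \<exists>v. computes f (m # xs) (Suc v)) \<Longrightarrow>
    computes (Minimize f) xs n"

lemma computes_functional: "computes f xs y \<Longrightarrow> computes f xs z \<Longrightarrow> y = z"
proof (induction arbitrary: z rule: computes.induct)
  case (Zero xs)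
  then show ?case by (auto elim: computes.cases)
next
  case (Succ x)
  then show ?case by (auto elim: computes.cases)
next
  case (Proj i xs)
  from Proj(2) show ?case by cases auto
next
  case (Comp ys gs xs f y)
  from Comp.prems obtain ys' where ys': "length ys' = length gs"
    "\<forall>i < length gs. computes (gs ! i) xs (ys' ! i)" "computes f ys' z"
    by cases auto
  have "ys = ys'"
    using Comp.hyps Comp.IH ys' by (intro nth_equalityI) auto
  then show ?case using Comp.IH ys' by blast
next
  case (PrimRec_0 f xs y g)
  from PrimRec_0.prems show ?case by cases (auto intro: PrimRec_0.IH)
next
  case (PrimRec_Suc f g n xs r y)
  from PrimRec_Suc.prems obtain r' where
    "computes (PrimRec f g) (n # xs) r'" "computes g (n # r' # xs) z"
    by cases auto
  then show ?case using PrimRec_Suc.IH by metis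
next
  case (Minimize f n xs)
  from Minimize.prems have z: "computes f (z # xs) 0" "\<forall>m < z. \<exists>v. computes f (m # xs) (Suc v)"
    by (cases, blast)+
  show ?case
  proof (cases n z rule: linorder_cases)
    case less
    then show ?thesis using z(2) Minimize.IH by fastforce
  next
    case greater
    then show ?thesis using z(1) Minimize.IH by fastforce
  qed
qed

definition decidable_set :: "nat set \<Rightarrow> bool" where
  "decidable_set A \<longleftrightarrow> (\<exists>f. \<forall>n. computes f [n] (if n \<in> A then 1 else 0))"


section \<open>Groups given by generators and relations\<close>

text \<open>A letter \<open>(x, True)\<close> stands for the generator \<open>x\<close>, a letter \<open>(x, False)\<close> for its inverse.\<close>

type_synonym 'g word = "('g \<times> bool) list"

inductive pres_equiv :: "('g word \<times> 'g word) set \<Rightarrow> 'g word \<Rightarrow> 'g word \<Rightarrow> bool"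
  for rels :: "('g word \<times> 'g word) set" where
  cancel: "pres_equiv rels [(x, e), (x, \<not> e)] []"
| rel: "(u, v) \<in> rels \<Longrightarrow> pres_equiv rels u v"
| congr: "pres_equiv rels u v \<Longrightarrow> pres_equiv rels (a @ u @ b) (a @ v @ b)"
| refl: "pres_equiv rels u u"
| sym: "pres_equiv rels u v \<Longrightarrow> pres_equiv rels v u"
| trans: "pres_equiv rels u v \<Longrightarrow> pres_equiv rels v w \<Longrightarrow> pres_equiv rels u w"

definition word_class :: "('g word \<times> 'g word) set \<Rightarrow> 'g word \<Rightarrow> 'g word set" where
  "word_class rels u = {v. pres_equiv rels u v}"

definition presented_group :: "('g word \<times> 'g word) set \<Rightarrow> 'g word set monoid" where
  "presented_group rels =
    \<lparr>carrier = range (word_class rels),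
     monoid.mult = \<lambda>A B. \<Union>u\<in>A. \<Union>v\<in>B. word_class rels (u @ v),
     one = word_class rels []\<rparr>"

datatype braid_gen = Sigma1 | Sigma2

definition braid_rels :: "(braid_gen word \<times> braid_gen word) set" where
  "braid_rels =
    {([(Sigma1, True), (Sigma2, True), (Sigma1, True)],
      [(Sigma2, True), (Sigma1, True), (Sigma2, True)])}"

definition B3 :: "braid_gen word set monoid" where
  "B3 = presented_group braid_rels"


section \<open>Laurent polynomials and general linear groups over explicit-carrier rings\<close>

text \<open>A Laurent polynomial over \<open>R\<close> is its family of coefficients, indexed by exponents in \<open>\<int>\<close>.\<close>

definition laurent_ring :: "('a, 'b) ring_scheme \<Rightarrow> (int \<Rightarrow> 'a) ring" where
  "laurent_ring R =
    \<lparr>carrier = {f. range f \<subseteq> carrier R \<and> finite {k. f k \<noteq> \<zero>\<^bsub>R\<^esub>}},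
     monoid.mult = \<lambda>f g k. \<Oplus>\<^bsub>R\<^esub>i\<in>{i. f i \<noteq> \<zero>\<^bsub>R\<^esub>}. f i \<otimes>\<^bsub>R\<^esub> g (k - i),
     one = \<lambda>k. if k = 0 then \<one>\<^bsub>R\<^esub> else \<zero>\<^bsub>R\<^esub>,
     zero = \<lambda>k. \<zero>\<^bsub>R\<^esub>,
     add = \<lambda>f g k. f k \<oplus>\<^bsub>R\<^esub> g k\<rparr>"

definition laurent_var :: "('a, 'b) ring_scheme \<Rightarrow> int \<Rightarrow> 'a" where
  "laurent_var R = (\<lambda>k. if k = 1 then \<one>\<^bsub>R\<^esub> else \<zero>\<^bsub>R\<^esub>)"

text \<open>The matrix operations of the matrix library refer to type classes, so they are
  restated here for a ring with explicit carrier.\<close>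

definition square_mats :: "nat \<Rightarrow> ('a, 'b) ring_scheme \<Rightarrow> 'a mat monoid" where
  "square_mats n R =
    \<lparr>carrier = {A \<in> carrier_mat n n. elements_mat A \<subseteq> carrier R},
     monoid.mult = \<lambda>A B. mat n n (\<lambda>(i, j). \<Oplus>\<^bsub>R\<^esub>k\<in>{..<n}. A $$ (i, k) \<otimes>\<^bsub>R\<^esub> B $$ (k, j)),
     one = mat n n (\<lambda>(i, j). if i = j then \<one>\<^bsub>R\<^esub> else \<zero>\<^bsub>R\<^esub>)\<rparr>"

definition GL :: "nat \<Rightarrow> ('a, 'b) ring_scheme \<Rightarrow> 'a mat monoid" where
  "GL n R = units_of (square_mats n R)"


section \<open>The Burau representation of the 3-strand braid group modulo a prime\<close>

abbreviation Fp_laurent :: "nat \<Rightarrow> (int \<Rightarrow> int) ring" where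
  "Fp_laurent p \<equiv> laurent_ring (residue_ring (int p))"

fun burau_gen :: "nat \<Rightarrow> braid_gen \<Rightarrow> (int \<Rightarrow> int) mat" where
  "burau_gen p Sigma1 =
    (let L = Fp_laurent p; t = laurent_var (residue_ring (int p)) in
     mat_of_rows_list 3
      [[\<one>\<^bsub>L\<^esub> \<ominus>\<^bsub>L\<^esub> t, t,       \<zero>\<^bsub>L\<^esub>],
       [\<one>\<^bsub>L\<^esub>,       \<zero>\<^bsub>L\<^esub>,      \<zero>\<^bsub>L\<^esub>],
       [\<zero>\<^bsub>L\<^esub>,       \<zero>\<^bsub>L\<^esub>,      \<one>\<^bsub>L\<^esub>]])"
| "burau_gen p Sigma2 =
    (let L = Fp_laurent p; t = laurent_var (residue_ring (int p)) in
     mat_of_rows_list 3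
      [[\<one>\<^bsub>L\<^esub>, \<zero>\<^bsub>L\<^esub>,       \<zero>\<^bsub>L\<^esub>],
       [\<zero>\<^bsub>L\<^esub>, \<one>\<^bsub>L\<^esub> \<ominus>\<^bsub>L\<^esub> t, t],
       [\<zero>\<^bsub>L\<^esub>, \<one>\<^bsub>L\<^esub>,       \<zero>\<^bsub>L\<^esub>]])"

definition eval_word :: "('h, 'b) monoid_scheme \<Rightarrow> ('g \<Rightarrow> 'h) \<Rightarrow> 'g word \<Rightarrow> 'h" where
  "eval_word G \<phi> w =
    foldr (\<lambda>(x, e) h. (if e then \<phi> x else inv\<^bsub>G\<^esub> (\<phi> x)) \<otimes>\<^bsub>G\<^esub> h) w \<one>\<^bsub>G\<^esub>"

text \<open>All words in a class have the same value, so that \<open>the_elem\<close> picks that value.\<close>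

definition burau :: "nat \<Rightarrow> braid_gen word set \<Rightarrow> (int \<Rightarrow> int) mat" where
  "burau p b = the_elem (eval_word (GL 3 (Fp_laurent p)) (burau_gen p) ` b)"

definition burau_faithful :: "nat \<Rightarrow> bool" where
  "burau_faithful p \<longleftrightarrow> inj_on (burau p) (carrier B3)"

end

theory Submission
  imports Defs "HOL-Library.Poly_Mapping"
begin

text \<open>
  The decision procedure answers yes on every prime, because the Burau representation of the
  3-strand braid group is faithful modulo every integer \<open>m > 1\<close>. What remains to be computed is
  primality.

  Faithfulness is a ping-pong argument in the modular group. The centre of the braid group is
  generated by the full twist, and the quotient by the centre is the free product of a group of
  order 2, generated by the half twist \<open>\<Delta> = s1 s2 s1\<close>, and a group of order 3, generated by
  \<open>\<delta> = s1 s2\<close>. Up to half twists on both sides and a central factor, each braid is therefore a product of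
  blocks \<open>\<delta> \<Delta>\<close> and \<open>\<delta>\<^sup>2 \<Delta>\<close> (lemma \<open>normalizable\<close>). In the reduced, two-dimensional Burau
  representation, a nonempty product of blocks has a matrix whose top-degree terms lie in the first
  row only, with leading coefficient \<open>1\<close> or \<open>-1\<close> in the upper left corner
  (lemma \<open>turn_monoid_dominant\<close>). These coefficients do not vanish modulo \<open>m\<close>, so the matrix is neither
  scalar nor antidiagonal, whereas powers of \<open>\<Delta>\<close> are scalar or antidiagonal. Hence a braid in the
  kernel has no blocks; it is a power of \<open>\<Delta>\<close>, and since the full twist acts as the scalar \<open>t\<^sup>3\<close>, it
  is trivial (lemma \<open>burau_mod_kernel_trivial\<close>).

  The matrix computations take place over integral Laurent polynomials. The coefficientwise
  reduction modulo \<open>m\<close> carries them to the ring with explicit carrier, and identifies the value of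
  \<^const>\<open>burau\<close> on a class of words with the reduction of an integral matrix
  (lemma \<open>burau_word_class\<close>).
\<close>

section \<open>A program for primality\<close>

lemma computes_ProjI: "i < length xs \<Longrightarrow> y = xs ! i \<Longrightarrow> computes (Proj i) xs y"
  using computes.Proj by simp

lemma computes_Comp1:
  "computes g xs a \<Longrightarrow> computes f [a] y \<Longrightarrow> computes (Comp f [g]) xs y"
  by (rule computes.Comp[where ys = "[a]"]) auto

lemma computes_Comp2:
  "computes g xs a \<Longrightarrow> computes h xs b \<Longrightarrow> computes f [a, b] y \<Longrightarrow>
   computes (Comp f [g, h]) xs y"
  by (rule computes.Comp[where ys = "[a, b]"]) (auto simp: less_Suc_eq)

lemma computes_Comp3:
  "computes g xs a \<Longrightarrow> computes h xs b \<Longrightarrow> computes i xs c \<Longrightarrow> computes f [a, b, c] y \<Longrightarrow>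
   computes (Comp f [g, h, i]) xs y"
  by (rule computes.Comp[where ys = "[a, b, c]"]) (auto simp: less_Suc_eq)

definition one_rf :: recf where
  "one_rf = Comp Succ [Zero]"

definition add_rf :: recf where
  "add_rf = PrimRec (Proj 0) (Comp Succ [Proj 1])"

definition mult_rf :: recf where
  "mult_rf = PrimRec Zero (Comp add_rf [Proj 1, Proj 2])"

definition pred_rf :: recf where
  "pred_rf = PrimRec Zero (Proj 0)"

definition monus_rf :: recf where
  "monus_rf = PrimRec (Proj 0) (Comp pred_rf [Proj 1])"

definition dist_rf :: recf where
  "dist_rf = Comp add_rf [monus_rf, Comp monus_rf [Proj 1, Proj 0]]"

definition sgn_rf :: recf where
  "sgn_rf = PrimRec Zero one_rf"

lemma computes_one: "computes one_rf xs 1"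
  unfolding one_rf_def by (auto intro: computes_Comp1 computes.intros)

lemma computes_add: "computes add_rf [x, y] (x + y)"
proof (induction x)
  case 0
  show ?case unfolding add_rf_def by (intro computes.PrimRec_0 computes_ProjI) auto
next
  case (Suc x)
  have "computes (Comp Succ [Proj 1]) [x, x + y, y] (Suc x + y)"
    by (rule computes_Comp1[where a = "x + y"]) (auto intro: computes_ProjI computes.Succ)
  then show ?case using Suc unfolding add_rf_def by (auto intro: computes.PrimRec_Suc)
qed

lemma computes_mult: "computes mult_rf [x, y] (x * y)"
proof (induction x)
  case 0
  show ?case unfolding mult_rf_def by (auto intro: computes.PrimRec_0 computes.Zero)
next
  case (Suc x)
  have "computes (Comp add_rf [Proj 1, Proj 2]) [x, x * y, y] (x * y + y)"
    by (rule computes_Comp2[where a = "x * y" and b = y])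
      (auto intro: computes_ProjI computes_add)
  then show ?case using Suc unfolding mult_rf_def
    by (auto intro: computes.PrimRec_Suc simp: add.commute)
qed

lemma computes_pred: "computes pred_rf [x] (x - 1)"
proof (induction x)
  case 0
  show ?case unfolding pred_rf_def by (auto intro: computes.PrimRec_0 computes.Zero)
next
  case (Suc x)
  have "computes (Proj 0) [x, x - 1] (Suc x - 1)" by (auto intro: computes_ProjI)
  then show ?case using Suc unfolding pred_rf_def by (auto intro: computes.PrimRec_Suc)
qed

lemma computes_monus: "computes monus_rf [x, y] (y - x)"
proof (induction x)
  case 0
  show ?case unfolding monus_rf_def by (intro computes.PrimRec_0 computes_ProjI) auto
next
  case (Suc x)
  have "computes (Comp pred_rf [Proj 1]) [x, y - x, y] (y - x - 1)"
    by (intro computes_Comp1[where a = "y - x"] computes_ProjI computes_pred) auto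
  then show ?case using Suc unfolding monus_rf_def by (auto intro: computes.PrimRec_Suc)
qed

lemma computes_dist: "computes dist_rf [x, y] ((y - x) + (x - y))"
proof -
  have "computes (Comp monus_rf [Proj 1, Proj 0]) [x, y] (x - y)"
    by (rule computes_Comp2[where a = y and b = x])
      (auto intro: computes_ProjI computes_monus)
  then show ?thesis unfolding dist_rf_def
    by (blast intro: computes_Comp2 computes_monus computes_add)
qed

lemma computes_sgn: "computes sgn_rf [x] (if x = 0 then 0 else 1)"
proof (induction x)
  case 0
  show ?case unfolding sgn_rf_def by (auto intro: computes.PrimRec_0 computes.Zero)
next
  case (Suc x)
  then show ?case unfolding sgn_rf_def
    by (auto intro: computes.PrimRec_Suc computes_one[simplified])
qed

text \<open>In the step of the recursion the arguments are the counter, the product so far and the parameters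
  \<open>xs\<close>; the factor only sees the counter and the parameters, hence the skipped position.\<close>

definition bounded_prod_rf :: "recf \<Rightarrow> nat \<Rightarrow> recf" where
  "bounded_prod_rf g k = PrimRec one_rf
     (Comp mult_rf [Proj 1, Comp g (Proj 0 # map (\<lambda>i. Proj (i + 2)) [0..<k])])"

lemma computes_bounded_prod:
  assumes "\<And>i. computes g (i # xs) (G i)"
  shows "computes (bounded_prod_rf g (length xs)) (n # xs) (\<Prod>i<n. G i)"
proof (induction n)
  case 0
  show ?case unfolding bounded_prod_rf_def
    by (auto intro: computes.PrimRec_0 computes_one[simplified])
next
  case (Suc n)
  let ?P = "\<Prod>i<n. G i"
  let ?gs = "Proj 0 # map (\<lambda>i. Proj (i + 2)) [0..<length xs]"
  have "computes (?gs ! i) (n # ?P # xs) ((n # xs) ! i)" if "i < length ?gs" for i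
    using that by (cases i) (auto intro!: computes_ProjI simp del: upt_Suc)
  then have "computes (Comp g ?gs) (n # ?P # xs) (G n)"
    by (intro computes.Comp[where ys = "n # xs"] assms) auto
  then have "computes (Comp mult_rf [Proj 1, Comp g ?gs]) (n # ?P # xs) (?P * G n)"
    by (intro computes_Comp2[where a = ?P and b = "G n"] computes_mult computes_ProjI) auto
  then show ?case using Suc unfolding bounded_prod_rf_def
    by (auto intro: computes.PrimRec_Suc)
qed

text \<open>The three arguments are \<open>b\<close>, \<open>a\<close>, \<open>p\<close>, and the result vanishes iff \<open>b * a = p\<close>.\<close>

definition factor_test_rf :: recf where
  "factor_test_rf = Comp dist_rf [Comp mult_rf [Proj 0, Proj 1], Proj 2]"

text \<open>This is the sign of \<open>(p - 1) * (\<Prod>a<p. \<Prod>b<p. \<bar>p - b * a\<bar>)\<close>, where \<open>p - 1\<close> is truncated and so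
  excludes 0 and 1. The double product is positive iff \<open>p\<close> is not a product of two smaller numbers.\<close>

definition prime_rf :: recf where
  "prime_rf = Comp sgn_rf [Comp mult_rf [pred_rf,
     Comp (bounded_prod_rf (Comp (bounded_prod_rf factor_test_rf 2) [Proj 1, Proj 0, Proj 1]) 1)
       [Proj 0, Proj 0]]]"

lemma prime_iff_no_product_of_smaller:
  "prime (p :: nat) \<longleftrightarrow> p > 1 \<and> (\<forall>a<p. \<forall>b<p. b * a \<noteq> p)"
proof
  assume p: "prime p"
  have "b * a \<noteq> p" if "a < p" "b < p" for a b
    using p that by (metis prime_product nat_mult_1 nat_mult_1_right nat_less_le)
  then show "p > 1 \<and> (\<forall>a<p. \<forall>b<p. b * a \<noteq> p)"
    using p prime_gt_1_nat by blast
next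
  assume *: "p > 1 \<and> (\<forall>a<p. \<forall>b<p. b * a \<noteq> p)"
  show "prime p"
    unfolding prime_nat_iff
  proof (intro conjI allI impI)
    fix m assume "m dvd p"
    then obtain k where k: "p = m * k" by (elim dvdE)
    with * have "m > 0" "k > 0" by (auto intro: Nat.gr0I)
    then have "m \<le> p" "k \<le> p" using k by auto
    with * k have "m = p \<or> k = p"
      by (metis le_neq_implies_less)
    then show "m = 1 \<or> m = p"
      using k * by auto
  qed (use * in auto)
qed

lemma computes_prime: "computes prime_rf [p] (if prime p then 1 else 0)"
proof -
  define G where "G b a = (p - b * a) + (b * a - p)" for a b
  define H where "H a = (\<Prod>b<p. G b a)" for a
  have G: "computes factor_test_rf [b, a, p] (G b a)" for a b
    unfolding factor_test_rf_def G_def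
    by (intro computes_Comp2[where a = "b * a" and b = p] computes_Comp2[where a = b and b = a]
        computes_dist computes_mult computes_ProjI) auto
  have H: "computes (Comp (bounded_prod_rf factor_test_rf 2) [Proj 1, Proj 0, Proj 1]) [a, p] (H a)"
    for a
    using computes_bounded_prod[of factor_test_rf "[a, p]" "\<lambda>b. G b a" p] G
    unfolding H_def
    by (intro computes_Comp3[where a = p and b = a and c = p]) (auto intro: computes_ProjI simp: eval_nat_numeral)
  have "computes prime_rf [p] (if (p - 1) * (\<Prod>a<p. H a) = 0 then 0 else 1)"
    unfolding prime_rf_def
    using computes_bounded_prod[of _ "[p]" H p, OF H]
    by (intro computes_Comp1[OF _ computes_sgn] computes_Comp2[OF computes_pred _ computes_mult]
        computes_Comp2[where a = p and b = p] computes_ProjI) auto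
  moreover have "(p - 1) * (\<Prod>a<p. H a) = 0 \<longleftrightarrow> \<not> prime p"
    unfolding prime_iff_no_product_of_smaller
    by (auto simp: H_def G_def)
  ultimately have "computes prime_rf [p] (if \<not> prime p then 0 else 1)"
    by (simp only:)
  then show ?thesis by (cases "prime p") simp_all
qed

section \<open>The braid group on three strands\<close>

text \<open>The quotient of words by \<^const>\<open>pres_equiv\<close> is made a type, so that computations with
  braids are equational.\<close>

lemma equivp_pres_equiv: "equivp (pres_equiv rels)"
  by (intro equivpI reflpI sympI transpI)
     (auto intro: pres_equiv.refl pres_equiv.sym pres_equiv.trans)

quotient_type braid = "braid_gen word" / "pres_equiv braid_rels"
  by (rule equivp_pres_equiv)

instantiation braid :: monoid_mult
begin
lift_definition one_braid :: braid is "[]" .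
lift_definition times_braid :: "braid \<Rightarrow> braid \<Rightarrow> braid" is "(@)"
proof -
  fix u u' v v' :: "braid_gen word"
  assume u: "pres_equiv braid_rels u u'" and v: "pres_equiv braid_rels v v'"
  have "pres_equiv braid_rels (u @ v) (u' @ v)"
    using pres_equiv.congr[OF u, of "[]" v] by simp
  moreover have "pres_equiv braid_rels (u' @ v) (u' @ v')"
    using pres_equiv.congr[OF v, of u' "[]"] by simp
  ultimately show "pres_equiv braid_rels (u @ v) (u' @ v')"
    by (rule pres_equiv.trans)
qed
instance by standard (transfer, simp add: pres_equiv.refl)+
end

lift_definition letter :: "braid_gen \<Rightarrow> bool \<Rightarrow> braid" is "\<lambda>x e. [(x, e)]" .

lemma letter_cancel: "letter x e * letter x (\<not> e) = 1"
  by transfer (simp add: pres_equiv.cancel)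

lemma braid_relation:
  "letter Sigma1 True * letter Sigma2 True * letter Sigma1 True =
   letter Sigma2 True * letter Sigma1 True * letter Sigma2 True"
  by transfer (simp add: pres_equiv.rel braid_rels_def)

lemma abs_braid_Cons: "abs_braid ((x, e) # w) = letter x e * abs_braid w"
  by (simp add: letter.abs_eq times_braid.abs_eq)

lemma braid_induct [case_names one letter]:
  assumes "P 1" and "\<And>x e w. P w \<Longrightarrow> P (letter x e * w)"
  shows "P w"
proof -
  obtain u where u: "w = abs_braid u" using braid.abs_induct[of "\<lambda>w. \<exists>u. w = abs_braid u" w] by blast
  have "P (abs_braid u)"
    by (induction u) (use assms in \<open>auto simp: abs_braid_Cons one_braid_def[symmetric]\<close>)
  then show ?thesis by (simp add: u)
qed

lemma braid_invertible: "\<exists>c. c * w = 1 \<and> w * c = (1 :: braid)"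
proof (induction w rule: braid_induct)
  case one
  show ?case by (intro exI[of _ 1]) simp
next
  case (letter x e w)
  then obtain c where c: "c * w = 1" "w * c = 1" by blast
  have l: "letter x e * letter x (\<not> e) = 1" "letter x (\<not> e) * letter x e = 1"
    using letter_cancel[of x e] letter_cancel[of x "\<not> e"] by simp_all
  have "c * letter x (\<not> e) * (letter x e * w) = c * (letter x (\<not> e) * letter x e) * w"
    "letter x e * w * (c * letter x (\<not> e)) = letter x e * (w * c) * letter x (\<not> e)"
    by (simp_all only: mult.assoc)
  then show ?case by (intro exI[of _ "c * letter x (\<not> e)"]) (simp add: c l)
qed

section \<open>A normal form for braids\<close>

abbreviation "s1 \<equiv> letter Sigma1 True"
abbreviation "s2 \<equiv> letter Sigma2 True"

text \<open>These braids turn the three strands by half a turn (the Garside element \<open>\<Delta>\<close>), by a third of a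
  turn, and by a full turn, which is central. Modulo the full twist the first two have orders 2 and 3
  and generate the free product of \<open>\<int>/2\<close> and \<open>\<int>/3\<close>, which is \<open>PSL(2, \<int>)\<close>.\<close>

definition half_twist :: braid where "half_twist = s1 * s2 * s1"
definition third_twist :: braid where "third_twist = s1 * s2"
definition full_twist :: braid where "full_twist = half_twist * half_twist"

lemma half_twist_s1: "half_twist * s1 = s2 * half_twist"
  using arg_cong[OF braid_relation, of "\<lambda>x. x * s1"] unfolding half_twist_def
  by (simp add: mult.assoc)

lemma half_twist_s2: "half_twist * s2 = s1 * half_twist"
  using arg_cong[OF braid_relation, of "\<lambda>x. s1 * x"] unfolding half_twist_def
  by (simp add: mult.assoc)

lemma full_twist_commutes_s: "full_twist * s1 = s1 * full_twist" "full_twist * s2 = s2 * full_twist"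
  unfolding full_twist_def by (metis half_twist_s1 half_twist_s2 mult.assoc)+

lemma full_twist_commutes:
  "full_twist * half_twist = half_twist * full_twist"
  "full_twist * third_twist = third_twist * full_twist"
  unfolding third_twist_def
  by (simp add: full_twist_def mult.assoc)
     (metis full_twist_commutes_s mult.assoc)

lemma full_twist_power_commutes:
  "full_twist ^ n * half_twist = half_twist * full_twist ^ n"
  "full_twist ^ n * third_twist = third_twist * full_twist ^ n"
  using full_twist_commutes by (metis power_commuting_commutes)+

lemma third_twist_cubed: "third_twist * third_twist * third_twist = full_twist"
proof -
  have "third_twist * third_twist * third_twist = half_twist * (s2 * s1 * s2)"
    by (simp add: third_twist_def half_twist_def mult.assoc)
  also have "\<dots> = full_twist"
    by (simp only: full_twist_def half_twist_def braid_relation)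
  finally show ?thesis .
qed

lemma half_twist_even_power: "half_twist ^ (2 * h) = full_twist ^ h"
  by (simp add: full_twist_def power_mult power2_eq_square)

lemma half_twist_power_cancel:
  assumes "half_twist ^ i * w * half_twist ^ j = half_twist ^ (i + j)"
  shows "w = 1"
proof -
  obtain c where c: "c * half_twist = 1" "half_twist * c = 1"
    using braid_invertible by blast
  have l: "c ^ i * half_twist ^ i = 1" and r: "half_twist ^ j * c ^ j = 1"
    using c by (simp_all add: left_right_inverse_power)
  have "w = c ^ i * half_twist ^ i * w * (half_twist ^ j * c ^ j)" by (simp add: l r)
  also have "\<dots> = c ^ i * (half_twist ^ i * w * half_twist ^ j) * c ^ j"
    by (simp only: mult.assoc)
  also have "\<dots> = c ^ i * half_twist ^ i * (half_twist ^ j * c ^ j)"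
    unfolding assms power_add by (simp only: mult.assoc)
  finally show ?thesis by (simp add: l r)
qed

text \<open>A reduced word in the free product of \<open>\<int>/2\<close> and \<open>\<int>/3\<close> alternates between the half twist and
  the first or second power of the third twist. Up to a half twist at either end such a word is a
  product of the two blocks used here, which equal \<open>full_twist * s2\<^sup>-\<^sup>1\<close> and \<open>full_twist * s1\<close>;
  their images in \<open>PSL(2, \<int>)\<close> are the two parabolic generators of the monoid of left and right turns.\<close>

inductive_set turn_monoid :: "braid set" where
  one: "1 \<in> turn_monoid"
| third: "x \<in> turn_monoid \<Longrightarrow> third_twist * half_twist * x \<in> turn_monoid"
| two_thirds: "x \<in> turn_monoid \<Longrightarrow> third_twist * third_twist * half_twist * x \<in> turn_monoid"

text \<open>The normal form is written without inverses: powers of the half twist are multiplied to both sides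
  of the braid instead of being divided out. All occurring matrices are then built from the
  left action of the two blocks and of the full twist.\<close>

definition normalizable :: "braid \<Rightarrow> bool" where
  "normalizable w \<longleftrightarrow> (\<exists>i j n. \<exists>x\<in>turn_monoid.
     half_twist ^ i * w * half_twist ^ j = full_twist ^ n * x)"

lemma normalizable_half_twist:
  assumes "normalizable w"
  shows "normalizable (half_twist * w)"
proof -
  obtain i j n x where x: "x \<in> turn_monoid"
    and eq: "half_twist ^ i * w * half_twist ^ j = full_twist ^ n * x"
    using assms unfolding normalizable_def by blast
  have "half_twist ^ (i + 1) * (half_twist * w) * half_twist ^ j =
      full_twist * (half_twist ^ i * w * half_twist ^ j)"
    unfolding full_twist_def by (metis power_Suc power_commutes mult.assoc Suc_eq_plus1)
  also have "\<dots> = full_twist ^ (n + 1) * x" unfolding eq by (simp add: mult.assoc)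
  finally show ?thesis unfolding normalizable_def using x by blast
qed

text \<open>Left multiplication by the third twist either prolongs the alternating word, or raises the exponent
  of its first third twist from 1 to 2, or from 2 to 3; in the last case the cube becomes a full twist
  and the word gets shorter. The parity of \<open>i\<close> tells whether the word starts with a half twist.\<close>

lemma normalizable_third_twist:
  assumes "normalizable w"
  shows "normalizable (third_twist * w)"
proof -
  obtain i j n x where x: "x \<in> turn_monoid"
    and eq: "half_twist ^ i * w * half_twist ^ j = full_twist ^ n * x"
    using assms unfolding normalizable_def by blast
  show ?thesis
  proof (cases "even i")
    case False
    then obtain h where h: "i + 1 = 2 * h" by (metis even_Suc evenE Suc_eq_plus1)
    have "half_twist ^ (i + 1) * (third_twist * w) * half_twist ^ j
        = third_twist * half_twist ^ (i + 1) * w * half_twist ^ j"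
      unfolding h half_twist_even_power
      by (simp add: full_twist_power_commutes mult.assoc[symmetric])
    also have "\<dots> = third_twist * half_twist * (full_twist ^ n * x)"
      by (simp add: mult.assoc eq[symmetric])
    also have "\<dots> = full_twist ^ n * (third_twist * half_twist * x)"
      by (metis full_twist_power_commutes mult.assoc)
    finally show ?thesis unfolding normalizable_def using turn_monoid.third[OF x] by blast
  next
    case True
    then obtain h where h: "i = 2 * h" by (elim evenE)
    have b: "half_twist ^ i * (third_twist * w) * half_twist ^ j = full_twist ^ n * (third_twist * x)"
    proof -
      have "half_twist ^ i * (third_twist * w) * half_twist ^ j
        = third_twist * (half_twist ^ i * w * half_twist ^ j)"
        unfolding h half_twist_even_power
        by (simp add: full_twist_power_commutes mult.assoc[symmetric])
      then show ?thesis
        by (simp add: eq full_twist_power_commutes mult.assoc[symmetric])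
    qed
    from x show ?thesis
    proof cases
      case one
      (* A half twist from the right completes the single third twist to a block. *)
      have "half_twist ^ i * (third_twist * w) * half_twist ^ (j + 1)
          = full_twist ^ n * (third_twist * half_twist * 1)"
        using b one by (simp only: power_add power_one_right mult_1_right mult.assoc[symmetric])
      then show ?thesis unfolding normalizable_def using turn_monoid.third[OF turn_monoid.one] by blast
    next
      case (third y)
      have "half_twist ^ i * (third_twist * w) * half_twist ^ j
          = full_twist ^ n * (third_twist * third_twist * half_twist * y)"
        using b third by (simp add: mult.assoc)
      then show ?thesis unfolding normalizable_def using turn_monoid.two_thirds[OF third(2)] by blast
    next
      case (two_thirds y)
      (* The cubed third twist leaves a half twist in front of y, which the additional factor on the
         left turns into a full twist. *)
      have "half_twist ^ (i + 1) * (third_twist * w) * half_twist ^ j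
          = half_twist * (full_twist ^ n * (third_twist * third_twist * third_twist * half_twist * y))"
        using b two_thirds by (simp add: mult.assoc)
      also have "\<dots> = full_twist ^ n * (half_twist * full_twist * half_twist * y)"
        unfolding third_twist_cubed by (simp add: full_twist_power_commutes mult.assoc[symmetric])
      also have "\<dots> = full_twist ^ (n + 2) * y"
      proof -
        have "half_twist * full_twist * half_twist = full_twist * full_twist"
          by (metis full_twist_commutes(1) full_twist_def mult.assoc)
        then show ?thesis by (simp only: power_add power2_eq_square mult.assoc)
      qed
      finally show ?thesis unfolding normalizable_def using two_thirds(2) by blast
    qed
  qed
qed

lemma normalizable_full_twist_cancel:
  assumes "normalizable (full_twist * w)"
  shows "normalizable w"
proof -
  obtain i j n x where x: "x \<in> turn_monoid"
    and eq: "half_twist ^ i * (full_twist * w) * half_twist ^ j = full_twist ^ n * x"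
    using assms unfolding normalizable_def by blast
  have "half_twist ^ (i + 2) * w * half_twist ^ j = full_twist ^ n * x"
    using eq by (simp only: full_twist_def power_add power2_eq_square mult.assoc)
  then show ?thesis unfolding normalizable_def using x by blast
qed

text \<open>Multiplication by central full twists turns each letter into a product of half and third twists.
  Hence a set of braids that is stable under left multiplication by these two and under cancelling
  full twists is stable under every letter.\<close>

lemma full_twist_letters:
  "full_twist * letter Sigma1 True = third_twist * third_twist * half_twist"
  "full_twist * (full_twist * letter Sigma2 True) = half_twist * third_twist * third_twist * half_twist * half_twist"
  "full_twist * letter Sigma1 False = half_twist * third_twist"
  "full_twist * letter Sigma2 False = third_twist * half_twist"
proof -
  show s: "full_twist * letter Sigma1 True = third_twist * third_twist * half_twist"
    unfolding third_twist_cubed[symmetric] half_twist_def third_twist_def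
    by (metis braid_relation mult.assoc)
  show "full_twist * (full_twist * letter Sigma2 True) = half_twist * third_twist * third_twist * half_twist * half_twist"
  proof -
    have "full_twist * (full_twist * s2) = half_twist * full_twist * (half_twist * s2)"
      by (simp add: full_twist_def mult.assoc)
    also have "\<dots> = half_twist * (full_twist * s1) * half_twist"
      by (simp only: half_twist_s2 mult.assoc)
    finally show ?thesis by (simp only: s mult.assoc)
  qed
  have inv: "s1 * letter Sigma1 False = 1" "s2 * letter Sigma2 False = 1"
    using letter_cancel[of _ True] by auto
  have "half_twist * letter Sigma1 False = s1 * s2"
    unfolding half_twist_def by (simp add: mult.assoc inv)
  then show "full_twist * letter Sigma1 False = half_twist * third_twist"
    by (simp add: full_twist_def third_twist_def mult.assoc)
  have "half_twist * letter Sigma2 False = s2 * s1"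
    unfolding half_twist_def braid_relation by (simp add: mult.assoc inv)
  then have "full_twist * letter Sigma2 False = half_twist * s2 * s1"
    by (simp add: full_twist_def mult.assoc)
  also have "\<dots> = third_twist * half_twist"
    by (simp add: half_twist_s2) (simp add: third_twist_def mult.assoc half_twist_s1)
  finally show "full_twist * letter Sigma2 False = third_twist * half_twist" .
qed

lemma normalizable: "normalizable w"
proof (induction w rule: braid_induct)
  case one
  have "half_twist ^ 0 * 1 * half_twist ^ 0 = full_twist ^ 0 * 1" by simp
  then show ?case unfolding normalizable_def using turn_monoid.one by blast
next
  case (letter x e w)
  note * = normalizable_half_twist normalizable_third_twist normalizable_full_twist_cancel
  consider "x = Sigma1" "e" | "x = Sigma2" "e" | "x = Sigma1" "\<not> e" | "x = Sigma2" "\<not> e"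
    by (cases x; cases e) auto
  then show ?case
  proof cases
    case 1
    have "normalizable (full_twist * (letter x e * w))"
      using 1 letter by (simp add: mult.assoc[symmetric] full_twist_letters)
        (simp add: mult.assoc *(1,2))
    then show ?thesis by (rule *)
  next
    case 2
    have "normalizable (full_twist * (full_twist * (letter x e * w)))"
      using 2 letter full_twist_letters(2) by (simp add: mult.assoc[symmetric])
        (simp add: mult.assoc *(1,2))
    then show ?thesis by (rule *(3)[OF *(3)])
  next
    case 3
    have "normalizable (full_twist * (letter x e * w))"
      using 3 letter by (simp add: mult.assoc[symmetric] full_twist_letters)
        (simp add: mult.assoc *(1,2))
    then show ?thesis by (rule *)
  next
    case 4
    have "normalizable (full_twist * (letter x e * w))"
      using 4 letter by (simp add: mult.assoc[symmetric] full_twist_letters)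
        (simp add: mult.assoc *(1,2))
    then show ?thesis by (rule *)
  qed
qed

section \<open>Burau matrices with integer coefficients\<close>

text \<open>Over the integers the ring of Laurent polynomials is an instance of \<^class>\<open>comm_ring_1\<close>, so that
  matrix identities are proved by rewriting. The coefficients are reduced only afterwards.\<close>

type_synonym laurent = "int \<Rightarrow>\<^sub>0 int"

abbreviation lookup :: "laurent \<Rightarrow> int \<Rightarrow> int" where
  "lookup \<equiv> Poly_Mapping.lookup"

definition tpow :: "int \<Rightarrow> laurent" where
  "tpow n = Poly_Mapping.single n 1"

lemma tpow_add: "tpow (m + n) = tpow m * tpow n"
  by (simp add: tpow_def mult_single)

lemma tpow_0 [simp]: "tpow 0 = 1"
  by (simp add: tpow_def)

lemma tpow_numeral:
  "tpow 2 = tpow 1 * tpow 1" "tpow 3 = tpow 1 * (tpow 1 * tpow 1)"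
  "tpow 4 = tpow 1 * (tpow 1 * (tpow 1 * tpow 1))"
  by (simp_all flip: tpow_add)

lemma lookup_mult_sum_keys:
  fixes f g :: laurent
  assumes "finite A" "Poly_Mapping.keys f \<subseteq> A"
  shows "lookup (f * g) k = (\<Sum>i\<in>A. lookup f i * lookup g (k - i))"
proof -
  have *: "(k = l + q) = (q = k - l)" for l q :: int by (auto simp: algebra_simps)
  have "lookup (f * g) k = Sum_any (\<lambda>l. lookup f l * lookup g (k - l))"
    by (simp add: lookup_mult * when_def)
  also have "\<dots> = (\<Sum>i\<in>A. lookup f i * lookup g (k - i))"
    using assms by (intro Sum_any.expand_superset) (auto simp: in_keys_iff)
  finally show ?thesis .
qed

lemma lookup_tpow_mult [simp]: "lookup (tpow n * x) k = lookup x (k - n)"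
  by (subst lookup_mult_sum_keys[where A = "{n}"]) (auto simp: tpow_def)

definition mat3 :: "'a \<Rightarrow> 'a \<Rightarrow> 'a \<Rightarrow> 'a \<Rightarrow> 'a \<Rightarrow> 'a \<Rightarrow> 'a \<Rightarrow> 'a \<Rightarrow> 'a \<Rightarrow> 'a mat" where
  "mat3 a b c d e f g h i = mat_of_rows_list 3 [[a, b, c], [d, e, f], [g, h, i]]"

lemma mat3_carrier [simp]: "mat3 a b c d e f g h i \<in> carrier_mat 3 3"
  by (simp add: mat3_def mat_of_rows_list_def numeral_3_eq_3)

lemma mat3_dim [simp]:
  "dim_row (mat3 a b c d e f g h i) = 3" "dim_col (mat3 a b c d e f g h i) = 3"
  by (simp_all add: mat3_def mat_of_rows_list_def numeral_3_eq_3)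

lemma mat3_index [simp]:
  "mat3 a b c d e f g h i $$ (0, 0) = a" "mat3 a b c d e f g h i $$ (0, 1) = b" "mat3 a b c d e f g h i $$ (0, 2) = c"
  "mat3 a b c d e f g h i $$ (1, 0) = d" "mat3 a b c d e f g h i $$ (1, 1) = e" "mat3 a b c d e f g h i $$ (1, 2) = f"
  "mat3 a b c d e f g h i $$ (2, 0) = g" "mat3 a b c d e f g h i $$ (2, 1) = h" "mat3 a b c d e f g h i $$ (2, 2) = i"
  by (simp_all add: mat3_def mat_of_rows_list_def eval_nat_numeral)

lemmas mat3_index_Suc [simp] = mat3_index[unfolded One_nat_def]

lemma mat_eq3I:
  assumes "A \<in> carrier_mat 3 3" "B \<in> carrier_mat 3 3"
    and "\<And>i j. i \<in> {0, 1, 2} \<Longrightarrow> j \<in> {0, 1, 2} \<Longrightarrow> A $$ (i, j) = B $$ (i, j)"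
  shows "A = B"
proof (rule eq_matI)
  fix i j assume "i < dim_row B" "j < dim_col B"
  then have "i < 3" "j < 3" using assms(2) by auto
  then have "i \<in> {0, 1, 2}" "j \<in> {0, 1, 2}" by auto
  then show "A $$ (i, j) = B $$ (i, j)" by (rule assms(3))
qed (use assms in auto)

lemma mult3_index:
  assumes "A \<in> carrier_mat 3 3" "B \<in> carrier_mat 3 3" "i < 3" "j < 3"
  shows "(A * B) $$ (i, j) = A $$ (i, 0) * B $$ (0, j) + A $$ (i, 1) * B $$ (1, j) + A $$ (i, 2) * B $$ (2, j)"
  using assms by (simp add: scalar_prod_def eval_nat_numeral)

lemma mat3_mult:
  "mat3 a b c d e f g h i * mat3 a' b' c' d' e' f' g' h' i' =
   mat3 (a * a' + b * d' + c * g') (a * b' + b * e' + c * h') (a * c' + b * f' + c * i')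
        (d * a' + e * d' + f * g') (d * b' + e * e' + f * h') (d * c' + e * f' + f * i')
        (g * a' + h * d' + i * g') (g * b' + h * e' + i * h') (g * c' + h * f' + i * i')"
  by (rule mat_eq3I) (auto simp: mult3_index simp del: index_mult_mat(1) intro: mult_carrier_mat[of _ 3 3])

lemma one_mat3: "1\<^sub>m 3 = mat3 1 0 0 0 1 0 0 0 1"
  by (rule mat_eq3I) auto

fun burau_letter :: "braid_gen \<Rightarrow> bool \<Rightarrow> laurent mat" where
  "burau_letter Sigma1 True = mat3 (1 - tpow 1) (tpow 1) 0  1 0 0  0 0 1"
| "burau_letter Sigma1 False = mat3 0 1 0  (tpow (-1)) (1 - tpow (-1)) 0  0 0 1"
| "burau_letter Sigma2 True = mat3 1 0 0  0 (1 - tpow 1) (tpow 1)  0 1 0"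
| "burau_letter Sigma2 False = mat3 1 0 0  0 0 1  0 (tpow (-1)) (1 - tpow (-1))"

definition burau_word :: "braid_gen word \<Rightarrow> laurent mat" where
  "burau_word w = foldr (\<lambda>(x, e) M. burau_letter x e * M) w (1\<^sub>m 3)"

lemma burau_letter_carrier [simp]: "burau_letter x e \<in> carrier_mat 3 3"
  by (cases "(x, e)" rule: burau_letter.cases) auto

lemma burau_word_Nil [simp]: "burau_word [] = 1\<^sub>m 3"
  and burau_word_Cons [simp]: "burau_word ((x, e) # w) = burau_letter x e * burau_word w"
  by (simp_all add: burau_word_def)

lemma burau_word_carrier [simp]: "burau_word w \<in> carrier_mat 3 3"
  by (induction w) (auto intro!: mult_carrier_mat[OF burau_letter_carrier])

lemma burau_word_append: "burau_word (u @ v) = burau_word u * burau_word v"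
  by (induction u)
     (auto simp: left_mult_one_mat[OF burau_word_carrier] assoc_mult_mat[OF burau_letter_carrier burau_word_carrier burau_word_carrier])

lemma tpow_inverse: "tpow 1 * tpow (-1) = 1" "tpow (-1) * tpow 1 = 1"
  by (simp_all flip: tpow_add)

lemma burau_letter_cancel: "burau_letter x e * burau_letter x (\<not> e) = 1\<^sub>m 3"
  unfolding one_mat3
  by (cases "(x, e)" rule: burau_letter.cases)
     (simp_all add: mat3_mult algebra_simps tpow_inverse)

lemma burau_word_respects:
  "pres_equiv braid_rels u v \<Longrightarrow> burau_word u = burau_word v"
proof (induction rule: pres_equiv.induct)
  case (cancel x e)
  then show ?case
    by (simp add: burau_letter_cancel right_mult_one_mat[OF burau_letter_carrier])
next
  case (rel u v)
  then show ?case
    by (auto simp: braid_rels_def one_mat3 mat3_mult algebra_simps)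
next
  case (congr u v a b)
  then show ?case by (simp add: burau_word_append)
qed auto

lift_definition burau_mat :: "braid \<Rightarrow> laurent mat" is burau_word
  by (rule burau_word_respects)

lemma burau_mat_carrier [simp]: "burau_mat w \<in> carrier_mat 3 3"
  by transfer simp

lemma burau_mat_mult: "burau_mat (u * v) = burau_mat u * burau_mat v"
  by transfer (simp add: burau_word_append)

lemma burau_mat_one: "burau_mat 1 = 1\<^sub>m 3"
  by transfer simp

lemma burau_mat_letter: "burau_mat (letter x e) = burau_letter x e"
  by transfer (simp add: right_mult_one_mat[OF burau_letter_carrier])

section \<open>Reduction of the coefficients modulo an integer\<close>

text \<open>Reduction maps the integral Laurent polynomials onto the ring of Laurent polynomials over the
  residues and respects all operations. The ring axioms and the monoid of matrices are obtained as images
  under this map instead of being proved from the convolution formula.\<close>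

definition reduce :: "int \<Rightarrow> laurent \<Rightarrow> int \<Rightarrow> int" where
  "reduce m f = (\<lambda>k. lookup f k mod m)"

abbreviation reduce_mat :: "int \<Rightarrow> laurent mat \<Rightarrow> (int \<Rightarrow> int) mat" where
  "reduce_mat m \<equiv> map_mat (reduce m)"

context residues
begin

abbreviation L :: "(int \<Rightarrow> int) ring" where
  "L \<equiv> laurent_ring R"

lemma carrier_laurent: "carrier L = range (reduce m)"
proof (intro equalityI subsetI)
  fix f assume "f \<in> carrier L"
  then have f: "range f \<subseteq> {0..m - 1}" "finite {k. f k \<noteq> 0}"
    by (auto simp: laurent_ring_def res_carrier_eq res_zero_eq)
  have "f k mod m = f k" for k
    using f(1) by (intro mod_pos_pos_trivial) (auto simp: image_subset_iff)
  then have "f = reduce m (Abs_poly_mapping f)"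
    using f(2) by (simp add: reduce_def Abs_poly_mapping_inverse)
  then show "f \<in> range (reduce m)" by blast
next
  fix f assume "f \<in> range (reduce m)"
  then obtain g where g: "f = reduce m g" by blast
  have "finite {k. lookup g k mod m \<noteq> 0}"
    by (rule finite_subset[OF _ finite_lookup[of g]]) auto
  then show "f \<in> carrier L"
    by (auto simp: laurent_ring_def g reduce_def res_zero_eq)
qed

lemma reduce_in_carrier [simp]: "reduce m f \<in> carrier L"
  by (simp add: carrier_laurent)

lemma reduce_zero: "reduce m 0 = \<zero>\<^bsub>L\<^esub>"
  by (simp add: reduce_def laurent_ring_def res_zero_eq)

lemma reduce_one: "reduce m 1 = \<one>\<^bsub>L\<^esub>"
  using m_gt_one by (auto simp: reduce_def laurent_ring_def res_zero_eq res_one_eq lookup_one when_def)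

lemma reduce_tpow_1: "reduce m (tpow 1) = laurent_var R"
  using m_gt_one
  by (auto simp: reduce_def laurent_var_def res_zero_eq res_one_eq tpow_def lookup_single when_def)

lemma reduce_add: "reduce m (f + g) = reduce m f \<oplus>\<^bsub>L\<^esub> reduce m g"
  by (simp add: reduce_def laurent_ring_def lookup_add res_add_eq mod_simps)

lemma reduce_mult: "reduce m (f * g) = reduce m f \<otimes>\<^bsub>L\<^esub> reduce m g"
proof
  fix k
  let ?A = "{i. lookup f i mod m \<noteq> 0}"
  have A: "?A \<subseteq> Poly_Mapping.keys f" by (auto simp: in_keys_iff)
  have "(reduce m f \<otimes>\<^bsub>L\<^esub> reduce m g) k
      = (\<Oplus>\<^bsub>R\<^esub>i\<in>?A. (lookup f i mod m * (lookup g (k - i) mod m)) mod m)"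
    by (simp add: laurent_ring_def reduce_def res_zero_eq res_mult_eq)
  also have "\<dots> = (\<Sum>i\<in>?A. lookup f i mod m * (lookup g (k - i) mod m)) mod m"
    using finite_subset[OF A finite_keys] by (rule sum_cong)
  also have "\<dots> = (\<Sum>i\<in>Poly_Mapping.keys f. lookup f i mod m * (lookup g (k - i) mod m)) mod m"
    by (rule arg_cong[where f = "\<lambda>x. x mod m"], rule sum.mono_neutral_left[OF _ A]) auto
  also have "\<dots> = (\<Sum>i\<in>Poly_Mapping.keys f. lookup f i * lookup g (k - i)) mod m"
    by (subst (1 2) mod_sum_eq[symmetric]) (simp add: mod_mult_eq)
  also have "\<dots> = lookup (f * g) k mod m"
    by (simp add: lookup_mult_sum_keys[of "Poly_Mapping.keys f"])
  finally show "reduce m (f * g) k = (reduce m f \<otimes>\<^bsub>L\<^esub> reduce m g) k"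
    by (simp add: reduce_def)
qed

lemma abelian_group_laurent: "abelian_group L"
proof (rule abelian_groupI)
  show "\<exists>y\<in>carrier L. y \<oplus>\<^bsub>L\<^esub> x = \<zero>\<^bsub>L\<^esub>" if "x \<in> carrier L" for x
  proof -
    obtain f where "x = reduce m f" using \<open>x \<in> carrier L\<close> by (auto simp: carrier_laurent)
    then have "reduce m (- f) \<oplus>\<^bsub>L\<^esub> x = \<zero>\<^bsub>L\<^esub>"
      by (simp flip: reduce_add reduce_zero)
    then show ?thesis by (intro bexI) auto
  qed
qed (auto simp: carrier_laurent ac_simps simp flip: reduce_zero reduce_add)

lemma reduce_diff: "reduce m (f - g) = reduce m f \<ominus>\<^bsub>L\<^esub> reduce m g"
proof -
  interpret L: abelian_group L by (rule abelian_group_laurent)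
  have "reduce m (- g) \<oplus>\<^bsub>L\<^esub> reduce m g = \<zero>\<^bsub>L\<^esub>"
    by (simp flip: reduce_add reduce_zero)
  then have "\<ominus>\<^bsub>L\<^esub> reduce m g = reduce m (- g)"
    by (intro L.minus_equality) auto
  then show ?thesis by (simp add: a_minus_def flip: reduce_add)
qed

lemma reduce_sum:
  assumes "finite A"
  shows "reduce m (\<Sum>i\<in>A. f i) = (\<Oplus>\<^bsub>L\<^esub>i\<in>A. reduce m (f i))"
proof -
  interpret L: abelian_group L by (rule abelian_group_laurent)
  show ?thesis using assms
    by (induction A) (auto simp: reduce_zero reduce_add)
qed

lemma carrier_square_mats: "carrier (square_mats n L) = reduce_mat m ` carrier_mat n n"
proof (intro equalityI subsetI)
  fix A assume "A \<in> carrier (square_mats n L)"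
  then have A: "A \<in> carrier_mat n n" "elements_mat A \<subseteq> range (reduce m)"
    by (auto simp: square_mats_def carrier_laurent)
  define B where "B = map_mat (inv_into UNIV (reduce m)) A"
  have "A = reduce_mat m B"
  proof (rule eq_matI)
    fix i j assume "i < dim_row (reduce_mat m B)" "j < dim_col (reduce_mat m B)"
    then have ij: "i < dim_row A" "j < dim_col A" by (auto simp: B_def)
    then have "A $$ (i, j) \<in> range (reduce m)" using A by (intro subsetD[OF A(2)]) auto
    then show "A $$ (i, j) = reduce_mat m B $$ (i, j)"
      using ij by (simp add: B_def f_inv_into_f)
  qed (auto simp: B_def)
  moreover have "B \<in> carrier_mat n n" using A(1) by (simp add: B_def)
  ultimately show "A \<in> reduce_mat m ` carrier_mat n n" by blast
qed (auto simp: square_mats_def elements_mat_def)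

lemma reduce_mat_mult:
  assumes "A \<in> carrier_mat n n" "B \<in> carrier_mat n n"
  shows "reduce_mat m (A * B) = reduce_mat m A \<otimes>\<^bsub>square_mats n L\<^esub> reduce_mat m B"
proof (rule eq_matI)
  fix i j
  assume "i < dim_row (reduce_mat m A \<otimes>\<^bsub>square_mats n L\<^esub> reduce_mat m B)"
    "j < dim_col (reduce_mat m A \<otimes>\<^bsub>square_mats n L\<^esub> reduce_mat m B)"
  then have ij: "i < n" "j < n" by (auto simp: square_mats_def)
  interpret L: abelian_group L by (rule abelian_group_laurent)
  have "(\<Oplus>\<^bsub>L\<^esub>k\<in>{..<n}. reduce m (A $$ (i, k) * B $$ (k, j)))
      = (\<Oplus>\<^bsub>L\<^esub>k\<in>{..<n}. reduce_mat m A $$ (i, k) \<otimes>\<^bsub>L\<^esub> reduce_mat m B $$ (k, j))"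
    by (rule L.finsum_cong') (use assms ij in \<open>auto simp flip: reduce_mult\<close>)
  then show "reduce_mat m (A * B) $$ (i, j)
      = (reduce_mat m A \<otimes>\<^bsub>square_mats n L\<^esub> reduce_mat m B) $$ (i, j)"
    using assms ij
    by (simp add: square_mats_def scalar_prod_def reduce_sum lessThan_atLeast0)
qed (use assms in \<open>auto simp: square_mats_def\<close>)

lemma reduce_mat_one: "reduce_mat m (1\<^sub>m n) = \<one>\<^bsub>square_mats n L\<^esub>"
  by (rule eq_matI) (auto simp: square_mats_def reduce_one reduce_zero)

lemma monoid_square_mats: "monoid (square_mats n L)"
proof (rule monoidI)
  fix A B C
  assume "A \<in> carrier (square_mats n L)" "B \<in> carrier (square_mats n L)"
    "C \<in> carrier (square_mats n L)"
  then obtain A' B' C' where *: "A' \<in> carrier_mat n n" "B' \<in> carrier_mat n n" "C' \<in> carrier_mat n n"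
    "A = reduce_mat m A'" "B = reduce_mat m B'" "C = reduce_mat m C'"
    by (auto simp: carrier_square_mats)
  then show "A \<otimes>\<^bsub>square_mats n L\<^esub> B \<otimes>\<^bsub>square_mats n L\<^esub> C =
      A \<otimes>\<^bsub>square_mats n L\<^esub> (B \<otimes>\<^bsub>square_mats n L\<^esub> C)"
    by (simp flip: reduce_mat_mult[of _ n])
next
  fix A assume "A \<in> carrier (square_mats n L)"
  then obtain A' where "A' \<in> carrier_mat n n" "A = reduce_mat m A'"
    by (auto simp: carrier_square_mats)
  then show "\<one>\<^bsub>square_mats n L\<^esub> \<otimes>\<^bsub>square_mats n L\<^esub> A = A"
    "A \<otimes>\<^bsub>square_mats n L\<^esub> \<one>\<^bsub>square_mats n L\<^esub> = A"
    by (simp_all flip: reduce_mat_one reduce_mat_mult[of _ n])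
qed (auto simp: carrier_square_mats simp flip: reduce_mat_one reduce_mat_mult)

lemma group_GL: "group (GL n L)"
  unfolding GL_def by (rule monoid.units_group[OF monoid_square_mats])

text \<open>The inverse in the group with explicit carrier is determined by the monoid equations alone, so it
  is the reduction of any integral inverse.\<close>

lemma inv_reduce_mat:
  assumes "A \<in> carrier_mat n n" "B \<in> carrier_mat n n" "A * B = 1\<^sub>m n" "B * A = 1\<^sub>m n"
  shows "inv\<^bsub>GL n L\<^esub> reduce_mat m A = reduce_mat m B"
proof -
  have AB: "reduce_mat m A \<otimes>\<^bsub>square_mats n L\<^esub> reduce_mat m B = \<one>\<^bsub>square_mats n L\<^esub>"
    "reduce_mat m B \<otimes>\<^bsub>square_mats n L\<^esub> reduce_mat m A = \<one>\<^bsub>square_mats n L\<^esub>"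
    by (simp_all add: assms flip: reduce_mat_mult[OF assms(1,2)] reduce_mat_mult[OF assms(2,1)] reduce_mat_one)
  have U: "reduce_mat m A \<in> carrier (GL n L)" "reduce_mat m B \<in> carrier (GL n L)"
    using assms(1,2) AB by (auto simp: GL_def units_of_carrier Units_def carrier_square_mats)
  show "inv\<^bsub>GL n L\<^esub> reduce_mat m A = reduce_mat m B"
    using AB U by (intro group.inv_equality[OF group_GL]) (simp_all add: GL_def units_of_mult units_of_one)
qed

end

lemma map_mat_mat3:
  "map_mat f (mat3 a b c d e g h i j) = mat3 (f a) (f b) (f c) (f d) (f e) (f g) (f h) (f i) (f j)"
  by (rule mat_eq3I) auto

lemma residues_nat: "p > 1 \<Longrightarrow> residues (int p)"
  by unfold_locales simp

lemma burau_gen_eq_reduce: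
  assumes "p > 1"
  shows "burau_gen p x = reduce_mat (int p) (burau_letter x True)"
proof -
  interpret residues "int p" "residue_ring (int p)"
    using assms by (simp_all add: residues_nat)
  show ?thesis
    by (cases x) (simp_all add: Let_def map_mat_mat3 reduce_diff reduce_one reduce_zero reduce_tpow_1
        flip: mat3_def)
qed

lemma eval_word_eq_reduce:
  assumes "p > 1"
  shows "eval_word (GL 3 (Fp_laurent p)) (burau_gen p) w = reduce_mat (int p) (burau_word w)"
proof -
  interpret residues "int p" "residue_ring (int p)"
    using assms by (simp_all add: residues_nat)
  have letter: "(if e then burau_gen p x else inv\<^bsub>GL 3 L\<^esub> burau_gen p x) = reduce_mat (int p) (burau_letter x e)"
    for x e
    using inv_reduce_mat[of "burau_letter x True" 3 "burau_letter x False"]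
      burau_letter_cancel[of x True] burau_letter_cancel[of x False]
    by (auto simp: burau_gen_eq_reduce[OF assms])
  show ?thesis
  proof (induction w)
    case Nil
    show ?case by (simp add: eval_word_def GL_def units_of_one reduce_mat_one)
  next
    case (Cons l w)
    obtain x e where l: "l = (x, e)" by (cases l)
    have "eval_word (GL 3 L) (burau_gen p) (l # w) =
        reduce_mat (int p) (burau_letter x e) \<otimes>\<^bsub>GL 3 L\<^esub> reduce_mat (int p) (burau_word w)"
      using Cons by (simp add: eval_word_def l letter)
    also have "\<dots> = reduce_mat (int p) (burau_letter x e * burau_word w)"
      by (simp add: GL_def units_of_mult reduce_mat_mult[of _ 3])
    finally show ?case by (simp add: l)
  qed
qed

lemma burau_word_class:
  assumes "p > 1"
  shows "burau p (word_class braid_rels u) = reduce_mat (int p) (burau_word u)"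
proof -
  have "eval_word (GL 3 (Fp_laurent p)) (burau_gen p) v = reduce_mat (int p) (burau_word u)"
    if "v \<in> word_class braid_rels u" for v
    using that burau_word_respects[of u v]
    by (simp add: word_class_def eval_word_eq_reduce[OF assms])
  moreover have "word_class braid_rels u \<noteq> {}"
    using pres_equiv.refl[of braid_rels u] by (auto simp: word_class_def)
  ultimately show ?thesis
    unfolding burau_def by (intro the_elem_image_unique)
qed

section \<open>Leading terms of the reduced Burau representation\<close>

text \<open>Every Burau matrix fixes the vector \<open>(1, 1, 1)\<close> and so acts on the quotient by this vector, which
  is the reduced, two-dimensional representation. The differences of consecutive entries are coordinates
  on the quotient. For column \<open>j\<close> of the matrix of \<open>w\<close> they form the pair \<open>(upper w j, lower w j)\<close>, on
  which left multiplication of \<open>w\<close> by a letter acts by a two-by-two matrix. At the identity braid the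
  columns \<open>j = 0\<close> and \<open>j = 2\<close> give the basis \<open>(1, 0)\<close>, \<open>(0, -1)\<close>.\<close>

definition upper :: "braid \<Rightarrow> nat \<Rightarrow> laurent" where
  "upper w j = burau_mat w $$ (0, j) - burau_mat w $$ (1, j)"

definition lower :: "braid \<Rightarrow> nat \<Rightarrow> laurent" where
  "lower w j = burau_mat w $$ (1, j) - burau_mat w $$ (2, j)"

lemma reduced_s1:
  assumes "j < 3"
  shows "upper (s1 * w) j = - tpow 1 * upper w j" "lower (s1 * w) j = upper w j + lower w j"
  unfolding upper_def lower_def burau_mat_mult burau_mat_letter
  by (simp_all add: mult3_index assms algebra_simps)

lemma reduced_s2:
  assumes "j < 3"
  shows "upper (s2 * w) j = upper w j + tpow 1 * lower w j" "lower (s2 * w) j = - tpow 1 * lower w j"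
  unfolding upper_def lower_def burau_mat_mult burau_mat_letter
  by (simp_all add: mult3_index assms algebra_simps)

lemma reduced_half_twist:
  assumes "j < 3"
  shows "upper (half_twist * w) j = - tpow 2 * lower w j" "lower (half_twist * w) j = - tpow 1 * upper w j"
  by (simp_all add: half_twist_def mult.assoc reduced_s1[OF assms] reduced_s2[OF assms] tpow_numeral algebra_simps)

lemma reduced_third_twist:
  assumes "j < 3"
  shows "upper (third_twist * w) j = - tpow 1 * upper w j - tpow 2 * lower w j"
    "lower (third_twist * w) j = upper w j"
  by (simp_all add: third_twist_def mult.assoc reduced_s1[OF assms] reduced_s2[OF assms] tpow_numeral algebra_simps)

lemma reduced_full_twist:
  assumes "j < 3"
  shows "upper (full_twist * w) j = tpow 3 * upper w j" "lower (full_twist * w) j = tpow 3 * lower w j"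
  by (simp_all add: full_twist_def mult.assoc reduced_half_twist[OF assms] tpow_numeral algebra_simps)

lemma reduced_full_twist_power:
  assumes "j < 3"
  shows "upper (full_twist ^ n * w) j = tpow (3 * int n) * upper w j \<and>
    lower (full_twist ^ n * w) j = tpow (3 * int n) * lower w j"
  by (induction n) (simp_all add: mult.assoc reduced_full_twist[OF assms] tpow_add distrib_left)

lemma reduced_one:
  "upper 1 0 = 1" "lower 1 0 = 0" "upper 1 2 = 0" "lower 1 2 = - 1"
  by (simp_all add: upper_def lower_def burau_mat_one)

text \<open>Among the entries of the reduced matrix the top degree \<open>N\<close> occurs only in the first row, and
  its coefficient in the corner is a unit that survives every reduction. This is the algebraic form of
  a ping-pong argument on the Bruhat-Tits tree of the place at infinity, where each further block moves
  the base vertex further away.\<close>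

definition dominant :: "braid \<Rightarrow> int \<Rightarrow> bool" where
  "dominant w N \<longleftrightarrow> \<bar>lookup (upper w 0) N\<bar> = 1 \<and>
     (\<forall>j\<in>{0, 2}. (\<forall>k>N. lookup (upper w j) k = 0) \<and> (\<forall>k\<ge>N. lookup (lower w j) k = 0))"

lemma reduced_third_half:
  assumes "j < 3"
  shows "upper (third_twist * half_twist * w) j = tpow 3 * (upper w j + lower w j)"
    "lower (third_twist * half_twist * w) j = - tpow 2 * lower w j"
  by (simp_all add: mult.assoc reduced_third_twist[OF assms] reduced_half_twist[OF assms]
      tpow_numeral algebra_simps)

lemma reduced_two_thirds_half:
  assumes "j < 3"
  shows "upper (third_twist * third_twist * half_twist * w) j = - tpow 4 * upper w j"
    "lower (third_twist * third_twist * half_twist * w) j = tpow 3 * (upper w j + lower w j)"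
  by (simp_all add: mult.assoc reduced_third_twist[OF assms] reduced_half_twist[OF assms]
      tpow_numeral algebra_simps)

text \<open>The two blocks act by \<open>(x, y) \<mapsto> (t\<^sup>3 (x + y), - t\<^sup>2 y)\<close> and \<open>(x, y) \<mapsto> (- t\<^sup>4 x, t\<^sup>3 (x + y))\<close>. Both
  let the degree of the first row grow by more than that of the second unless the first row feeds the
  second, and then it does so in lower degree. The identity is not dominant, because its second row has
  degree 0 as well; a single block already repairs this.\<close>

lemma dominant_third_half:
  assumes "dominant w N \<or> w = 1 \<and> N = 0"
  shows "dominant (third_twist * half_twist * w) (N + 3)"
  using assms
  (* For w = 1 the factor 1 is kept, because the product rules expect a braid to the right of the block. *)
  by (auto simp: dominant_def reduced_third_half reduced_one lookup_add lookup_one simp del: mult_1_right)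

lemma dominant_two_thirds_half:
  assumes "dominant w N \<or> w = 1 \<and> N = 0"
  shows "dominant (third_twist * third_twist * half_twist * w) (N + 4)"
  using assms
  by (auto simp: dominant_def reduced_two_thirds_half reduced_one lookup_add lookup_one simp del: mult_1_right)

lemma turn_monoid_dominant:
  "x \<in> turn_monoid \<Longrightarrow> x = 1 \<or> (\<exists>N. dominant x N)"
  by (induction rule: turn_monoid.induct) (use dominant_third_half dominant_two_thirds_half in blast)+

section \<open>Faithfulness modulo every integer above one\<close>

lemma reduce_mat_burau_mult:
  assumes "m > 1"
    and "reduce_mat m (burau_mat v) = reduce_mat m (burau_mat w)"
  shows "reduce_mat m (burau_mat (x * v * y)) = reduce_mat m (burau_mat (x * w * y))"
proof -
  interpret residues m "residue_ring m" using assms by unfold_locales simp_all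
  have "reduce_mat m (burau_mat (u * u')) =
      reduce_mat m (burau_mat u) \<otimes>\<^bsub>square_mats 3 L\<^esub> reduce_mat m (burau_mat u')" for u u'
    by (simp add: burau_mat_mult reduce_mat_mult[of _ 3])
  then show ?thesis by (simp add: assms(2))
qed

lemma reduced_entries_cong:
  assumes "reduce_mat m (burau_mat v) = reduce_mat m (burau_mat w)" and "j < 3"
  shows "lookup (upper v j) k mod m = lookup (upper w j) k mod m"
    and "lookup (lower v j) k mod m = lookup (lower w j) k mod m"
proof -
  have "lookup (burau_mat v $$ (i, j)) k mod m = lookup (burau_mat w $$ (i, j)) k mod m" if "i < 3" for i
  proof -
    have "reduce_mat m (burau_mat v) $$ (i, j) = reduce_mat m (burau_mat w) $$ (i, j)"
      by (simp add: assms)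
    then show ?thesis
      using that assms(2) carrier_matD[OF burau_mat_carrier[of v]] carrier_matD[OF burau_mat_carrier[of w]]
      by (simp add: reduce_def fun_eq_iff)
  qed
  then show "lookup (upper v j) k mod m = lookup (upper w j) k mod m"
      "lookup (lower v j) k mod m = lookup (lower w j) k mod m"
    by (auto simp: upper_def lower_def lookup_minus intro: mod_diff_cong)
qed

text \<open>Even powers of the half twist are scalar in the reduced representation, whereas odd powers have
  zeros on the diagonal. A matrix with a dominant corner has neither shape.\<close>

lemma reduced_even_power:
  "upper (half_twist ^ (2 * h)) 0 = tpow (3 * int h)" "lower (half_twist ^ (2 * h)) 2 = - tpow (3 * int h)"
  using reduced_full_twist_power[of 0 h 1] reduced_full_twist_power[of 2 h 1]
  by (simp_all add: half_twist_even_power reduced_one)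

lemma reduced_odd_power:
  "upper (half_twist ^ (2 * h + 1)) 0 = 0"
proof -
  have "half_twist ^ (2 * h + 1) = full_twist ^ h * half_twist * 1"
    unfolding power_add half_twist_even_power by simp
  then show ?thesis
    using reduced_full_twist_power[of 0 h "half_twist * 1"]
    by (simp add: mult.assoc reduced_half_twist reduced_one del: mult_1_right)
qed

text \<open>If \<open>w\<close> lies in the kernel, then its normal form \<open>full_twist ^ n * x\<close> has the same image as a power
  of the half twist. The corner entry of \<open>x\<close> is nonzero, which excludes an odd power. For an even power
  the image is scalar, so that \<open>x\<close> is not dominant and hence trivial, and comparison of degrees
  determines the exponent.\<close>

lemma burau_mod_kernel_trivial:
  assumes m: "m > 1" and ker: "reduce_mat m (burau_mat w) = reduce_mat m (1\<^sub>m 3)"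
  shows "w = 1"
proof -
  have one_mod: "1 mod m = 1" using m by simp
  obtain i j n x where x: "x \<in> turn_monoid"
    and eq: "half_twist ^ i * w * half_twist ^ j = full_twist ^ n * x"
    using normalizable[of w] unfolding normalizable_def by blast
  have "reduce_mat m (burau_mat (half_twist ^ i * w * half_twist ^ j)) =
      reduce_mat m (burau_mat (half_twist ^ i * 1 * half_twist ^ j))"
    by (rule reduce_mat_burau_mult) (simp_all add: m ker burau_mat_one)
  then have img: "reduce_mat m (burau_mat (full_twist ^ n * x)) = reduce_mat m (burau_mat (half_twist ^ (i + j)))"
    by (simp add: eq power_add)
  note cong = reduced_entries_cong[OF img]
  have shift: "lookup (upper (full_twist ^ n * x) j) k = lookup (upper x j) (k - 3 * int n)"
    "lookup (lower (full_twist ^ n * x) j) k = lookup (lower x j) (k - 3 * int n)" if "j < 3" for j k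
    using reduced_full_twist_power[OF that, of n x] by simp_all
  have unit: "c mod m \<noteq> 0" if "\<bar>c\<bar> = 1" for c
  proof
    assume "c mod m = 0"
    then have "m dvd \<bar>c\<bar>" by auto
    then show False using that m by (simp add: zdvd1_eq)
  qed
  have nonzero_upper: "\<exists>k. lookup (upper (full_twist ^ n * x) 0) k mod m \<noteq> 0"
  proof (cases "x = 1")
    case True
    then show ?thesis using shift(1)[of 0 "3 * int n"] unit[of 1]
      by (intro exI[of _ "3 * int n"]) (simp add: reduced_one)
  next
    case False
    then obtain N where "dominant x N" using turn_monoid_dominant[OF x] by blast
    then show ?thesis using shift(1)[of 0 "N + 3 * int n"] unit
      by (intro exI[of _ "N + 3 * int n"]) (simp add: dominant_def)
  qed
  have "even (i + j)"
  proof (rule ccontr)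
    assume "odd (i + j)"
    then obtain h where "i + j = 2 * h + 1" by (elim oddE)
    then show False using nonzero_upper cong(1)[of 0] reduced_odd_power[of h] by simp
  qed
  then obtain h where h: "i + j = 2 * h" by (elim evenE)
  (* In an even power of the half twist the diagonal entries are equal up to the sign of the basis (0, -1),
     whereas in degree N + 3 n only the first diagonal entry of full_twist ^ n * x is nonzero. *)
  have "x = 1"
  proof (rule ccontr)
    assume "x \<noteq> 1"
    then obtain N where N: "dominant x N" using turn_monoid_dominant[OF x] by blast
    let ?k = "N + 3 * int n"
    have "lookup (upper x 0) N mod m = lookup (tpow (3 * int h)) ?k mod m"
      using cong(1)[of 0 ?k] by (simp add: shift h reduced_even_power)
    moreover have "lookup (tpow (3 * int h)) ?k mod m = 0"
      using cong(2)[of 2 ?k] N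
      by (simp add: shift h reduced_even_power dominant_def mod_eq_0_iff_dvd)
    ultimately show False using unit N by (simp add: dominant_def)
  qed
  moreover have "n = h"
  proof -
    have "upper (full_twist ^ n) 0 = tpow (3 * int n)"
      using reduced_full_twist_power[of 0 n 1] by (simp add: reduced_one)
    then show ?thesis
      using cong(1)[of 0 "3 * int n"] one_mod
      by (simp add: h reduced_even_power \<open>x = 1\<close> tpow_def lookup_single when_def split: if_splits)
  qed
  ultimately have "half_twist ^ i * w * half_twist ^ j = half_twist ^ (i + j)"
    by (simp add: eq h half_twist_even_power)
  then show ?thesis by (rule half_twist_power_cancel)
qed

lemma burau_faithful_mod:
  assumes p: "p > 1"
  shows "burau_faithful p"
  unfolding burau_faithful_def
proof (rule inj_onI)
  fix A B assume "A \<in> carrier B3" "B \<in> carrier B3" and eq: "burau p A = burau p B"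
  then obtain u v where AB: "A = word_class braid_rels u" "B = word_class braid_rels v"
    by (auto simp: B3_def presented_group_def)
  let ?U = "abs_braid u" and ?V = "abs_braid v"
  have UV: "reduce_mat (int p) (burau_mat ?U) = reduce_mat (int p) (burau_mat ?V)"
    using eq by (simp add: AB burau_word_class[OF p] burau_mat.abs_eq)
  obtain c where c: "c * ?V = 1" "?V * c = 1" using braid_invertible by blast
  have "reduce_mat (int p) (burau_mat (c * ?U)) = reduce_mat (int p) (burau_mat (c * ?V))"
    using reduce_mat_burau_mult[OF _ UV, of c 1] p by simp
  then have "c * ?U = 1"
    by (intro burau_mod_kernel_trivial[of "int p"]) (use p in \<open>simp_all add: c burau_mat_one\<close>)
  then have "?U = ?V"
    using c by (metis mult.assoc mult_1_left mult_1_right)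
  then have "pres_equiv braid_rels u v" by (simp add: braid.abs_eq_iff)
  then show "A = B"
    by (auto simp: AB word_class_def intro: pres_equiv.trans pres_equiv.sym)
qed

theorem theorem1p1:
  shows "(\<exists>f. \<forall>p. prime p \<longrightarrow> computes f [p] (if burau_faithful p then 1 else 0)) \<and>
         decidable_set {p. prime p \<and> burau_faithful p}"
proof
  have faithful: "burau_faithful p" if "prime p" for p
    using that by (intro burau_faithful_mod prime_gt_1_nat)
  show "\<exists>f. \<forall>p. prime p \<longrightarrow> computes f [p] (if burau_faithful p then 1 else 0)"
    using faithful computes_one by (intro exI[of _ one_rf]) simp
  have "{p. prime p \<and> burau_faithful p} = {p. prime p}"
    using faithful by blast
  then show "decidable_set {p. prime p \<and> burau_faithful p}"
    unfolding decidable_set_def using computes_prime by (intro exI[of _ prime_rf]) simp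
qed

end
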